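(* Let $\varphi$ be a $\mathrm{D}$-formula. The DFA $\tilde{\mathcal{N}}_\varphi$ accepts exactly the nonempty finite words $w$ over $2^{\mathcal{AP}}$ such that $w\models\varphi$.
   Context: Formulas: $\varphi ::= p\mid\neg\varphi\mid\varphi\vee\varphi\mid\langle D\rangle\varphi$, $p\in\mathcal{AP}$ (finite); $[D]\psi:=\neg\langle D\rangle\neg\psi$. Semantics on interval models over finite linear orders: $\langle D\rangle\psi$ holds on $[x,y]$ iff $\psi$ holds on some $[x',y']$ with $x\le x'$, $y'\le y$, $[x',y']\ne[x,y]$. For a nonempty word $w$ over $2^{\mathcal{AP}}$, $\mathbf{M}(w)$ is the interval model over $\{0,\dots,|w|-1\}$ with $[x,y]\in\mathcal{V}(p)$ iff $p\in w[x']$ for all $x'\in[x,y]$ ($w[i]$ the $(i+1)$-th letter); $w\models\varphi$ iff $\mathbf{M}(w),[0,|w|-1]\models\varphi$. $\mathrm{CL}(\varphi)$: subformulas of $\varphi$ and their negations, identifying $\neg\neg\psi$ with $\psi$ and $\neg\langle D\rangle\psi$ with $[D]\neg\psi$. A $\varphi$-atom is $A\subseteq\mathrm{CL}(\varphi)$ with $\psi\in A$ iff $\neg\psi\notin A$ and $\psi_1\vee\psi_2\in A$ iff ($\psi_1\in A$ or $\psi_2\in A$), for all relevant formulas in $\mathrm{CL}(\varphi)$. $\mathcal{R}eq_D(A)=\{\psi:\langle D\rangle\psi\in A\}$, $\mathrm{REQ}_\varphi=\{\psi:\langle D\rangle\psi\in\mathrm{CL}(\varphi)\}$, $\mathcal{O}bs_D(A)=A\cap\mathrm{REQ}_\varphi$.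 $A\,D_\varphi\,A'$ iff for every $[D]\psi\in A$, $\psi\in A'$ and $[D]\psi\in A'$. $A_1A_2\Rightarrow A_3$ iff $A_3\cap\mathcal{AP}=A_1\cap A_2\cap\mathcal{AP}$ and $\mathcal{R}eq_D(A_3)=\mathcal{R}eq_D(A_1)\cup\mathcal{R}eq_D(A_2)\cup\mathcal{O}bs_D(A_1)\cup\mathcal{O}bs_D(A_2)$. A $\varphi$-row is a nonempty sequence $row[0]\cdots row[n-1]$ of atoms with $row[i+1]\,D_\varphi\,row[i]$ and $row[i]\cap\mathcal{AP}\supseteq row[i+1]\cap\mathcal{AP}$; initialized if $\mathcal{R}eq_D(row[0])=\emptyset$. Maximal factorization $A_0^{m_0}\cdots A_k^{m_k}$ ($m_i>0$, $A_i\neq A_{i+1}$). $rank(A)=|\mathrm{REQ}_\varphi|-|\mathcal{R}eq_D(A)|$. Two rows are equivalent ($\sim$) iff their maximal factorizations have the same number of blocks, the same atoms $A_i$, and for each $i$ either equal exponents or both exponents $>rank(A_i)$. A row is minimal if each exponent $m_i\le rank(A_i)+1$. $succ_\varphi(row,A)=B_0\cdots B_n$ ($n=|row|$) with $B_0=A$ and $row[i]B_i\Rightarrow B_{i+1}$; $succ^{min}_\varphi(row,A)$ is the unique minimal row equivalent to it. For $P\subseteq\mathcal{AP}$, $A(P)$ is the unique $\varphi$-atom with $A(P)\cap\mathcal{AP}=P\cap\mathrm{CL}(\varphi)$ and $\mathcal{R}eq_D(A(P))=\emptyset$. $\tilde{\mathcal{N}}_\varphi$ is the DFA over alphabet $2^{\mathcal{AP}}$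 with states the initialized minimal $\varphi$-rows plus a fresh initial state $\tilde q_1$; $\tilde\delta(\tilde q_1,P)$ is the one-letter row $A(P)$, $\tilde\delta(row,P)=succ^{min}_\varphi(row,A(P))$; accepting states are the rows $row$ with $\varphi\in row[|row|-1]$. *)

theory Defs
  imports Main
begin

section \<open>The logic D of sub-intervals\<close>

text \<open>The set of proposition letters is the (finite) type \<open>'p\<close>. There is no
  formula over an empty set of letters, so non-emptiness of types is harmless.\<close>

datatype 'p fm = Atm 'p | Neg "'p fm" | Or "'p fm" "'p fm" | Dia "'p fm"

definition Box :: "'p fm \<Rightarrow> 'p fm" where
  "Box \<psi> = Neg (Dia (Neg \<psi>))"

text \<open>An interval model is given by its set of points \<open>S\<close> and its valuation \<open>V\<close>.
  An interval is a pair \<open>(x, y)\<close> with \<open>x \<le> y\<close>; one-point intervals are allowed.\<close>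

primrec sat :: "'a::linorder set \<Rightarrow> ('p \<Rightarrow> ('a \<times> 'a) set) \<Rightarrow> 'a \<times> 'a \<Rightarrow> 'p fm \<Rightarrow> bool" where
  "sat S V I (Atm p) \<longleftrightarrow> I \<in> V p"
| "sat S V I (Neg \<psi>) \<longleftrightarrow> \<not> sat S V I \<psi>"
| "sat S V I (Or \<psi>1 \<psi>2) \<longleftrightarrow> sat S V I \<psi>1 \<or> sat S V I \<psi>2"
| "sat S V I (Dia \<psi>) \<longleftrightarrow>
     (\<exists>x'\<in>S. \<exists>y'\<in>S. x' \<le> y' \<and> fst I \<le> x' \<and> y' \<le> snd I \<and> (x', y') \<noteq> I \<and> sat S V (x', y') \<psi>)"

definition word_val :: "'p set list \<Rightarrow> 'p \<Rightarrow> (nat \<times> nat) set" where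
  "word_val w p = {(x, y). x \<le> y \<and> y < length w \<and> (\<forall>x'\<in>{x..y}. p \<in> w ! x')}"

definition word_sat :: "'p set list \<Rightarrow> 'p fm \<Rightarrow> bool" where
  "word_sat w \<phi> \<longleftrightarrow> sat {0..<length w} (word_val w) (0, length w - 1) \<phi>"


section \<open>Closure and atoms\<close>

text \<open>The closure is taken modulo \<open>\<not>\<not>\<psi> \<approx> \<psi>\<close> and \<open>\<not>\<langle>D\<rangle>\<psi> \<approx> [D]\<not>\<psi>\<close>. A class is represented
  by its unique member without double negations, computed by \<open>nf\<close>; lemma
  \<open>nf_eq_iff\<close> below confirms that \<open>nf\<close> identifies exactly these formulas. Since atoms consist
  of representatives, a formula \<open>\<psi>\<close> belongs to an atom \<open>A\<close> iff \<open>nf \<psi> \<in> A\<close>.\<close>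

inductive ident :: "'p fm \<Rightarrow> 'p fm \<Rightarrow> bool" where
  dneg: "ident (Neg (Neg \<psi>)) \<psi>"
| box: "ident (Neg (Dia \<psi>)) (Box (Neg \<psi>))"
| refl: "ident \<psi> \<psi>"
| sym: "ident \<psi> \<chi> \<Longrightarrow> ident \<chi> \<psi>"
| trans: "ident \<psi> \<chi> \<Longrightarrow> ident \<chi> \<theta> \<Longrightarrow> ident \<psi> \<theta>"
| Neg: "ident \<psi> \<chi> \<Longrightarrow> ident (Neg \<psi>) (Neg \<chi>)"
| Or: "ident \<psi>1 \<chi>1 \<Longrightarrow> ident \<psi>2 \<chi>2 \<Longrightarrow> ident (Or \<psi>1 \<psi>2) (Or \<chi>1 \<chi>2)"
| Dia: "ident \<psi> \<chi> \<Longrightarrow> ident (Dia \<psi>) (Dia \<chi>)"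

fun nneg :: "'p fm \<Rightarrow> 'p fm" where
  "nneg (Neg \<psi>) = \<psi>"
| "nneg \<psi> = Neg \<psi>"

primrec nf :: "'p fm \<Rightarrow> 'p fm" where
  "nf (Atm p) = Atm p"
| "nf (Neg \<psi>) = nneg (nf \<psi>)"
| "nf (Or \<psi>1 \<psi>2) = Or (nf \<psi>1) (nf \<psi>2)"
| "nf (Dia \<psi>) = Dia (nf \<psi>)"

lemma ident_nf: "ident \<psi> (nf \<psi>)"
proof (induction \<psi>)
  case (Neg \<psi>)
  have "ident (Neg \<chi>) (nneg \<chi>)" for \<chi> :: "'p fm"
    by (cases \<chi>) (auto intro: ident.intros)
  with Neg show ?case by (auto intro: ident.trans[OF ident.Neg])
qed (auto intro: ident.intros)

lemma nneg_nneg_nf: "nneg (nneg (nf \<psi>)) = nf \<psi>"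
proof (induction \<psi>)
  case (Neg \<psi>)
  then show ?case by simp
qed auto

lemma nf_eq_iff: "nf \<psi> = nf \<chi> \<longleftrightarrow> ident \<psi> \<chi>"
proof
  assume "nf \<psi> = nf \<chi>"
  then show "ident \<psi> \<chi>" by (metis ident_nf ident.sym ident.trans)
next
  assume "ident \<psi> \<chi>"
  then show "nf \<psi> = nf \<chi>"
    by (induction rule: ident.induct) (auto simp: nneg_nneg_nf Box_def)
qed

primrec subfms :: "'p fm \<Rightarrow> 'p fm set" where
  "subfms (Atm p) = {Atm p}"
| "subfms (Neg \<psi>) = insert (Neg \<psi>) (subfms \<psi>)"
| "subfms (Or \<psi>1 \<psi>2) = insert (Or \<psi>1 \<psi>2) (subfms \<psi>1 \<union> subfms \<psi>2)"
| "subfms (Dia \<psi>) = insert (Dia \<psi>) (subfms \<psi>)"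

definition CL :: "'p fm \<Rightarrow> 'p fm set" where
  "CL \<phi> = nf ` (subfms \<phi> \<union> Neg ` subfms \<phi>)"

definition is_atom :: "'p fm \<Rightarrow> 'p fm set \<Rightarrow> bool" where
  "is_atom \<phi> A \<longleftrightarrow> A \<subseteq> CL \<phi>
     \<and> (\<forall>\<psi>\<in>CL \<phi>. \<psi> \<in> A \<longleftrightarrow> nf (Neg \<psi>) \<notin> A)
     \<and> (\<forall>\<psi>1 \<psi>2. Or \<psi>1 \<psi>2 \<in> CL \<phi> \<longrightarrow> (Or \<psi>1 \<psi>2 \<in> A \<longleftrightarrow> \<psi>1 \<in> A \<or> \<psi>2 \<in> A))"

definition letters :: "'p fm set \<Rightarrow> 'p set" where
  "letters A = {p. Atm p \<in> A}"

definition Req :: "'p fm set \<Rightarrow> 'p fm set" where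
  "Req A = {\<psi>. Dia \<psi> \<in> A}"

definition REQ :: "'p fm \<Rightarrow> 'p fm set" where
  "REQ \<phi> = {\<psi>. Dia \<psi> \<in> CL \<phi>}"

definition Obs :: "'p fm \<Rightarrow> 'p fm set \<Rightarrow> 'p fm set" where
  "Obs \<phi> A = A \<inter> REQ \<phi>"

definition D_rel :: "'p fm set \<Rightarrow> 'p fm set \<Rightarrow> bool" where
  "D_rel A A' \<longleftrightarrow> (\<forall>\<psi>. nf (Box \<psi>) \<in> A \<longrightarrow> nf \<psi> \<in> A' \<and> nf (Box \<psi>) \<in> A')"

definition gen :: "'p fm \<Rightarrow> 'p fm set \<Rightarrow> 'p fm set \<Rightarrow> 'p fm set \<Rightarrow> bool" where
  "gen \<phi> A1 A2 A3 \<longleftrightarrow> letters A3 = letters A1 \<inter> letters A2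
     \<and> Req A3 = Req A1 \<union> Req A2 \<union> Obs \<phi> A1 \<union> Obs \<phi> A2"

definition rank :: "'p fm \<Rightarrow> 'p fm set \<Rightarrow> nat" where
  "rank \<phi> A = card (REQ \<phi>) - card (Req A)"

definition atom_of :: "'p fm \<Rightarrow> 'p set \<Rightarrow> 'p fm set" where
  "atom_of \<phi> P = (THE A. is_atom \<phi> A \<and> letters A = P \<inter> letters (CL \<phi>) \<and> Req A = {})"


section \<open>Rows\<close>

definition is_row :: "'p fm \<Rightarrow> 'p fm set list \<Rightarrow> bool" where
  "is_row \<phi> row \<longleftrightarrow> row \<noteq> [] \<and> (\<forall>A\<in>set row. is_atom \<phi> A)
     \<and> (\<forall>i. Suc i < length row \<longrightarrow>
           D_rel (row ! Suc i) (row ! i) \<and> letters (row ! Suc i) \<subseteq> letters (row ! i))"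

definition initialized :: "'p fm set list \<Rightarrow> bool" where
  "initialized row \<longleftrightarrow> Req (row ! 0) = {}"

text \<open>\<open>max_fact row [(A\<^sub>0, m\<^sub>0), \<dots>, (A\<^sub>k, m\<^sub>k)]\<close> says that \<open>A\<^sub>0^m\<^sub>0 \<cdots> A\<^sub>k^m\<^sub>k\<close> is the maximal
  factorization of \<open>row\<close>.\<close>

definition max_fact :: "'a list \<Rightarrow> ('a \<times> nat) list \<Rightarrow> bool" where
  "max_fact row fs \<longleftrightarrow> row = concat (map (\<lambda>(A, m). replicate m A) fs)
     \<and> (\<forall>(A, m)\<in>set fs. m > 0) \<and> distinct_adj (map fst fs)"

definition row_equiv :: "'p fm \<Rightarrow> 'p fm set list \<Rightarrow> 'p fm set list \<Rightarrow> bool" where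
  "row_equiv \<phi> row row' \<longleftrightarrow> (\<exists>fs gs. max_fact row fs \<and> max_fact row' gs
     \<and> list_all2 (\<lambda>(A, m) (B, n). A = B \<and> (m = n \<or> m > rank \<phi> A \<and> n > rank \<phi> A)) fs gs)"

definition minimal :: "'p fm \<Rightarrow> 'p fm set list \<Rightarrow> bool" where
  "minimal \<phi> row \<longleftrightarrow> (\<exists>fs. max_fact row fs \<and> (\<forall>(A, m)\<in>set fs. m \<le> rank \<phi> A + 1))"

definition succ_row :: "'p fm \<Rightarrow> 'p fm set list \<Rightarrow> 'p fm set \<Rightarrow> 'p fm set list" where
  "succ_row \<phi> row A = (THE Bs. length Bs = length row + 1 \<and> (\<forall>B\<in>set Bs. is_atom \<phi> B)
     \<and> Bs ! 0 = A \<and> (\<forall>i<length row. gen \<phi> (row ! i) (Bs ! i) (Bs ! (i + 1))))"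

definition succ_min :: "'p fm \<Rightarrow> 'p fm set list \<Rightarrow> 'p fm set \<Rightarrow> 'p fm set list" where
  "succ_min \<phi> row A =
     (THE row'. is_row \<phi> row' \<and> minimal \<phi> row' \<and> row_equiv \<phi> (succ_row \<phi> row A) row')"


section \<open>The automaton\<close>

record ('q, 'a) automaton =
  states :: "'q set"
  init :: 'q
  delta :: "'q \<Rightarrow> 'a \<Rightarrow> 'q"
  final :: "'q set"

definition is_dfa :: "('q, 'a) automaton \<Rightarrow> bool" where
  "is_dfa M \<longleftrightarrow> finite (states M) \<and> init M \<in> states M \<and> final M \<subseteq> states M
     \<and> (\<forall>q\<in>states M. \<forall>a. delta M q a \<in> states M)"

definition language :: "('q, 'a) automaton \<Rightarrow> 'a list set" where
  "language M = {w. foldl (delta M) (init M) w \<in> final M}"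

text \<open>\<open>None\<close> is the fresh initial state, \<open>Some row\<close> the state \<open>row\<close>.\<close>

definition row_states :: "'p fm \<Rightarrow> 'p fm set list set" where
  "row_states \<phi> = {row. is_row \<phi> row \<and> initialized row \<and> minimal \<phi> row}"

definition N_aut :: "'p fm \<Rightarrow> ('p fm set list option, 'p set) automaton" where
  "N_aut \<phi> = \<lparr>
     states = insert None (Some ` row_states \<phi>),
     init = None,
     delta = (\<lambda>q P. case q of
         None \<Rightarrow> Some [atom_of \<phi> P]
       | Some row \<Rightarrow> Some (succ_min \<phi> row (atom_of \<phi> P))),
     final = Some ` {row \<in> row_states \<phi>. nf \<phi> \<in> row ! (length row - 1)} \<rparr>"

end

theory Submission imports Defs begin

text \<open>Along a word, the column of the atoms of all intervals that end in a fixed position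
  is computed from the previous column by \<open>succ_row\<close>. A minimal row is obtained by cutting each
  block \<open>A\<^sup>m\<close> of a row down to at most \<open>rank A + 1\<close> copies. Such cutting commutes with the successor:
  while \<open>\<Rightarrow>\<close> is iterated against a constant atom \<open>A\<close>, the set of requests grows strictly until it
  stabilises, hence after at most \<open>rank A + 1\<close> steps, and each strict growth lowers the rank by at
  least one, so the stable atom is still repeated more often than its own rank.\<close>

section \<open>Atoms\<close>

lemma finite_CL: "finite (CL \<phi>)"
proof -
  have "finite (subfms \<psi>)" for \<psi> :: "'p fm"
    by (induction \<psi>) auto
  then show ?thesis
    unfolding CL_def by blast
qed

lemma subfms_refl: "\<psi> \<in> subfms \<psi>"
  by (cases \<psi>) auto

lemma subfms_trans: "\<chi> \<in> subfms \<psi> \<Longrightarrow> subfms \<chi> \<subseteq> subfms \<psi>"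
  by (induction \<psi>) auto

text \<open>Normalization only deletes pairs of negations, so every subformula that survives
  represents an old one. This keeps \<open>CL\<close> closed under subformulas although it consists
  of representatives.\<close>

lemma subfms_nf: "subfms (nf \<psi>) \<subseteq> nf ` subfms \<psi>"
proof (induction \<psi>)
  case (Neg \<psi>)
  show ?case
  proof (cases "nf \<psi>")
    case (Neg \<theta>)
    with Neg.IH show ?thesis by auto
  qed (use Neg.IH in auto)
qed auto

lemma subfms_CL:
  assumes "\<psi> \<in> CL \<phi>" "\<chi> \<in> subfms \<psi>"
  shows "\<chi> \<in> CL \<phi>"
proof -
  obtain \<theta> where \<theta>: "\<theta> \<in> subfms \<phi>" "\<psi> = nf \<theta> \<or> \<psi> = nf (Neg \<theta>)"
    using assms(1) unfolding CL_def by auto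
  have "nf ` subfms \<theta> \<subseteq> CL \<phi>" "nf ` subfms (Neg \<theta>) \<subseteq> CL \<phi>"
    using subfms_trans[OF \<theta>(1)] \<theta>(1) unfolding CL_def subfms.simps by blast+
  moreover have "\<chi> \<in> nf ` subfms \<theta> \<or> \<chi> \<in> nf ` subfms (Neg \<theta>)"
    using \<theta>(2) assms(2) subfms_nf[of \<theta>] subfms_nf[of "Neg \<theta>"] by (elim disjE) (simp_all only: subset_iff, simp_all)
  ultimately show ?thesis
    by blast
qed

lemma CL_Neg: "Neg \<psi> \<in> CL \<phi> \<Longrightarrow> \<psi> \<in> CL \<phi>"
  and CL_Or: "Or \<psi> \<chi> \<in> CL \<phi> \<Longrightarrow> \<psi> \<in> CL \<phi> \<and> \<chi> \<in> CL \<phi>"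
  and CL_Dia: "Dia \<psi> \<in> CL \<phi> \<Longrightarrow> \<psi> \<in> CL \<phi>"
  by (auto intro: subfms_CL simp: subfms_refl)

lemma nf_nf: "nf (nf \<psi>) = nf \<psi>"
  by (simp add: nf_eq_iff ident.sym ident_nf)

lemma nf_CL: "\<psi> \<in> CL \<phi> \<Longrightarrow> nf \<psi> = \<psi>"
  by (auto simp: CL_def nf_nf simp del: nf.simps)

lemma nf_Neg_nf: "nf (Neg (nf \<psi>)) = nf (Neg \<psi>)"
  by (simp add: nf_nf)

lemma nf_Neg_CL: "\<psi> \<in> CL \<phi> \<Longrightarrow> nf (Neg \<psi>) \<in> CL \<phi>"
proof -
  assume "\<psi> \<in> CL \<phi>"
  then obtain \<theta> where \<theta>: "\<theta> \<in> subfms \<phi>" "\<psi> = nf \<theta> \<or> \<psi> = nf (Neg \<theta>)"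
    by (auto simp: CL_def simp del: nf.simps)
  then have "nf (Neg \<psi>) = nf (Neg \<theta>) \<or> nf (Neg \<psi>) = nf \<theta>"
    by (metis nf_Neg_nf nf.simps(2) nneg_nneg_nf)
  then show ?thesis
    using \<theta>(1) unfolding CL_def by blast
qed

lemma self_CL: "nf \<phi> \<in> CL \<phi>"
  by (auto simp: CL_def subfms_refl)

section \<open>Atoms as boolean valuations\<close>

text \<open>Two valuations are used for \<open>v\<close>: \<open>eval_fm\<close>, for atoms with
  prescribed letters and requests, and \<open>sat\<close> at a fixed interval.\<close>

definition truths :: "'p fm \<Rightarrow> ('p fm \<Rightarrow> bool) \<Rightarrow> 'p fm set" where
  "truths \<phi> v = {\<psi> \<in> CL \<phi>. v \<psi>}"

lemma is_atom_truths:
  assumes Neg: "\<And>\<psi>. v (Neg \<psi>) \<longleftrightarrow> \<not> v \<psi>" and Or: "\<And>\<psi> \<chi>. v (Or \<psi> \<chi>) \<longleftrightarrow> v \<psi> \<or> v \<chi>"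
  shows "is_atom \<phi> (truths \<phi> v)"
proof -
  have "v (nneg \<psi>) \<longleftrightarrow> \<not> v \<psi>" for \<psi>
    by (cases \<psi>) (simp_all add: Neg)
  then show ?thesis
    using nf_Neg_CL unfolding is_atom_def truths_def
    by (auto simp: Or nf_CL dest: CL_Or)
qed

text \<open>Diamonds count as boolean variables, so letters and requests can be prescribed
  independently.\<close>

primrec eval_fm :: "'p set \<Rightarrow> 'p fm set \<Rightarrow> 'p fm \<Rightarrow> bool" where
  "eval_fm P R (Atm p) \<longleftrightarrow> p \<in> P"
| "eval_fm P R (Neg \<psi>) \<longleftrightarrow> \<not> eval_fm P R \<psi>"
| "eval_fm P R (Or \<psi> \<chi>) \<longleftrightarrow> eval_fm P R \<psi> \<or> eval_fm P R \<chi>"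
| "eval_fm P R (Dia \<psi>) \<longleftrightarrow> \<psi> \<in> R"

definition mk_atom :: "'p fm \<Rightarrow> 'p set \<Rightarrow> 'p fm set \<Rightarrow> 'p fm set" where
  "mk_atom \<phi> P R = truths \<phi> (eval_fm P R)"

lemma is_atom_mk_atom: "is_atom \<phi> (mk_atom \<phi> P R)"
  by (simp add: mk_atom_def is_atom_truths)

lemma letters_mk_atom: "letters (mk_atom \<phi> P R) = P \<inter> letters (CL \<phi>)"
  and Req_mk_atom: "Req (mk_atom \<phi> P R) = R \<inter> REQ \<phi>"
  by (auto simp: mk_atom_def truths_def letters_def Req_def REQ_def)

text \<open>The atom conditions settle negation and disjunction, so only letters and diamonds are
  free; the induction stops at diamonds. Hence letters and requests determine an atom.\<close>

lemma is_atom_in_iff: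
  assumes "is_atom \<phi> A" "\<psi> \<in> CL \<phi>"
  shows "\<psi> \<in> A \<longleftrightarrow> eval_fm (letters A) (Req A) \<psi>"
  using assms(2)
proof (induction \<psi>)
  case (Neg \<psi>)
  then have "\<psi> \<in> CL \<phi>"
    by (simp add: CL_Neg)
  \<comment> \<open>The negation condition for atoms is applied to \<open>Neg \<psi>\<close>, whose
    normalized negation is \<open>\<psi>\<close>.\<close>
  have "nf (Neg (Neg \<psi>)) = \<psi>"
    using nf_CL[OF \<open>\<psi> \<in> CL \<phi>\<close>] by (metis nf.simps(2) nneg_nneg_nf)
  then have "Neg \<psi> \<in> A \<longleftrightarrow> \<psi> \<notin> A"
    using assms(1) Neg.prems unfolding is_atom_def by metis
  then show ?case
    using Neg.IH \<open>\<psi> \<in> CL \<phi>\<close> by simp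
next
  case (Or \<psi> \<chi>)
  then show ?case
    using assms(1) CL_Or[OF Or.prems] unfolding is_atom_def by (metis eval_fm.simps(3))
qed (auto simp: letters_def Req_def)

lemma mk_atom_eq:
  assumes "is_atom \<phi> A"
  shows "mk_atom \<phi> (letters A) (Req A) = A"
proof -
  have "A \<subseteq> CL \<phi>"
    using assms by (simp add: is_atom_def)
  then show ?thesis
    using is_atom_in_iff[OF assms] unfolding mk_atom_def truths_def by blast
qed

lemma is_atom_eqI:
  "\<lbrakk>is_atom \<phi> A; is_atom \<phi> B; letters A = letters B; Req A = Req B\<rbrakk> \<Longrightarrow> A = B"
  by (metis mk_atom_eq)

lemma letters_subset: "is_atom \<phi> A \<Longrightarrow> letters A \<subseteq> letters (CL \<phi>)"
  and Req_subset: "is_atom \<phi> A \<Longrightarrow> Req A \<subseteq> REQ \<phi>"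
  by (auto simp: is_atom_def letters_def Req_def REQ_def)

lemma finite_REQ: "finite (REQ \<phi>)"
proof -
  have "REQ \<phi> = Dia -` CL \<phi>"
    by (auto simp: REQ_def)
  then show ?thesis
    by (simp add: finite_vimageI finite_CL inj_def)
qed

lemma finite_atoms: "finite {A. is_atom \<phi> A}"
  by (rule finite_subset[of _ "Pow (CL \<phi>)"]) (auto simp: is_atom_def finite_CL)

lemma atom_of_eq: "atom_of \<phi> P = mk_atom \<phi> P {}"
  unfolding atom_of_def
proof (rule the_equality)
  show "is_atom \<phi> (mk_atom \<phi> P {}) \<and> letters (mk_atom \<phi> P {}) = P \<inter> letters (CL \<phi>)
      \<and> Req (mk_atom \<phi> P {}) = {}"
    by (simp add: is_atom_mk_atom letters_mk_atom Req_mk_atom)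
qed (rule is_atom_eqI[of \<phi>]; simp add: is_atom_mk_atom letters_mk_atom Req_mk_atom)

text \<open>The relation \<open>gen\<close> as a function, possible because its conditions fix the
  letters and requests of the third atom.\<close>

definition gen_atom :: "'p fm \<Rightarrow> 'p fm set \<Rightarrow> 'p fm set \<Rightarrow> 'p fm set" where
  "gen_atom \<phi> A B =
     mk_atom \<phi> (letters A \<inter> letters B) (Req A \<union> Req B \<union> Obs \<phi> A \<union> Obs \<phi> B)"

lemma is_atom_gen_atom: "is_atom \<phi> (gen_atom \<phi> A B)"
  by (simp add: gen_atom_def is_atom_mk_atom)

lemma gen_gen_atom: "is_atom \<phi> A \<Longrightarrow> is_atom \<phi> B \<Longrightarrow> gen \<phi> A B (gen_atom \<phi> A B)"
  using letters_subset[of \<phi> A] Req_subset[of \<phi> A] Req_subset[of \<phi> B]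
  by (auto simp: gen_def gen_atom_def letters_mk_atom Req_mk_atom Obs_def)

lemma gen_iff:
  assumes "is_atom \<phi> A" "is_atom \<phi> B" "is_atom \<phi> C"
  shows "gen \<phi> A B C \<longleftrightarrow> C = gen_atom \<phi> A B"
proof
  assume "gen \<phi> A B C"
  with gen_gen_atom[OF assms(1,2)] show "C = gen_atom \<phi> A B"
    by (intro is_atom_eqI[OF assms(3) is_atom_gen_atom]) (simp_all add: gen_def)
qed (simp add: gen_gen_atom assms)

text \<open>A box normalizes to \<open>Neg (Dia \<chi>)\<close>, so a box in \<open>A\<close> is a
  request missing from \<open>A\<close>. By \<open>sub\<close>, \<open>\<chi>\<close> is then
  neither requested nor observed in \<open>B\<close>, which puts the box and its argument into
  \<open>B\<close>.\<close>

lemma D_relI: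
  assumes A: "is_atom \<phi> A" and B: "is_atom \<phi> B" and sub: "Req B \<union> Obs \<phi> B \<subseteq> Req A"
  shows "D_rel A B"
  unfolding D_rel_def
proof (intro allI impI)
  fix \<psi>
  assume "nf (Box \<psi>) \<in> A"
  define \<chi> where "\<chi> = nneg (nf \<psi>)"
  have box: "nf (Box \<psi>) = Neg (Dia \<chi>)"
    by (simp add: Box_def \<chi>_def)
  have CL: "Neg (Dia \<chi>) \<in> CL \<phi>" "Dia \<chi> \<in> CL \<phi>" "\<chi> \<in> CL \<phi>"
    using \<open>nf (Box \<psi>) \<in> A\<close> A box unfolding is_atom_def by (auto dest: CL_Neg CL_Dia)
  then have "\<chi> \<notin> Req A"
    using \<open>nf (Box \<psi>) \<in> A\<close> is_atom_in_iff[OF A CL(1)] box by simp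
  then have "\<chi> \<notin> Req B" "\<chi> \<notin> B"
    using sub CL by (auto simp: Obs_def REQ_def)
  moreover have "nf \<psi> = nf (Neg \<chi>)"
    using nf_CL[OF CL(3)] by (simp add: \<chi>_def nneg_nneg_nf)
  ultimately show "nf \<psi> \<in> B \<and> nf (Box \<psi>) \<in> B"
    using is_atom_in_iff[OF B CL(1)] B CL(3) unfolding box is_atom_def by auto
qed


section \<open>Trimming the blocks of a list\<close>

text \<open>Later \<open>k\<close> is \<open>rank \<phi>\<close>. The list is rebuilt from its right
  end, and a copy of \<open>a\<close> is dropped exactly when \<open>Suc (k a)\<close> copies
  already stand in front; this makes cutting accessible to structural induction.\<close>

definition push :: "('a \<Rightarrow> nat) \<Rightarrow> 'a \<Rightarrow> 'a list \<Rightarrow> 'a list" where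
  "push k a xs = (if take (Suc (k a)) xs = replicate (Suc (k a)) a then xs else a # xs)"

definition trim :: "('a \<Rightarrow> nat) \<Rightarrow> 'a list \<Rightarrow> 'a list" where
  "trim k xs = foldr (push k) xs []"

lemma trim_Nil [simp]: "trim k [] = []"
  and trim_Cons [simp]: "trim k (a # xs) = push k a (trim k xs)"
  by (simp_all add: trim_def)

lemma push_neq_Nil [simp]: "push k a xs \<noteq> []"
  and hd_push [simp]: "hd (push k a xs) = a"
  and last_push: "last (push k a xs) = (if xs = [] then a else last xs)"
  by (cases xs; auto simp: push_def)+

lemma trim_eq_Nil_iff [simp]: "trim k xs = [] \<longleftrightarrow> xs = []"
  by (cases xs) auto

lemma hd_trim: "hd (trim k xs) = hd xs"
  by (cases xs) auto

lemma last_trim: "last (trim k xs) = last xs"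
  by (induction xs) (auto simp: last_push)

lemma set_trim: "set (trim k xs) \<subseteq> set xs"
  by (induction xs) (auto simp: push_def)

lemma sorted_wrt_trim: "sorted_wrt R xs \<Longrightarrow> sorted_wrt R (trim k xs)"
proof (induction xs)
  case (Cons a xs)
  then show ?case
    using set_trim[of k xs] by (auto simp: push_def)
qed simp

lemma successively_trim: "successively R xs \<Longrightarrow> successively R (trim k xs)"
  by (induction xs) (auto simp: push_def successively_Cons hd_trim)

text \<open>An element between two copies of \<open>a\<close> is related to \<open>a\<close> in both
  directions, hence equal to it. So all copies of the head form a prefix.\<close>

lemma take_sorted_wrt_eq_replicate:
  assumes "sorted_wrt R (a # xs)" "antisymp_on (set (a # xs)) R" "n \<le> count_list xs a"
  shows "take n xs = replicate n a"
  using assms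
proof (induction xs arbitrary: n)
  case (Cons b xs)
  show ?case
  proof (cases "a = b")
    case True
    then have "take (n - 1) xs = replicate (n - 1) a"
      using Cons.prems by (intro Cons.IH) auto
    then show ?thesis
      using True by (cases n) auto
  next
    case False
    then have "a \<notin> set xs"
      using Cons.prems by (auto dest: antisymp_onD)
    then show ?thesis
      using Cons.prems(3) False by (simp add: count_notin)
  qed
qed simp

text \<open>Cutting bounds single blocks; sortedness merges all copies of an element into one block
  and so bounds their total number. This serves the finiteness of the state set.\<close>

lemma count_list_trim:
  assumes "sorted_wrt R xs" "antisymp_on (set xs) R"
  shows "count_list (trim k xs) a \<le> Suc (k a)"
  using assms
proof (induction xs)
  case (Cons b xs)
  have sub: "set (trim k xs) \<subseteq> set xs"
    by (rule set_trim)
  have IH: "count_list (trim k xs) a \<le> Suc (k a)"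
    using Cons by (auto intro: antisymp_on_subset)
  have "sorted_wrt R (trim k xs)"
    using Cons.prems(1) sorted_wrt_trim by auto
  then have "sorted_wrt R (b # trim k xs)"
    using Cons.prems(1) sub by auto
  moreover have "antisymp_on (set (b # trim k xs)) R"
    using Cons.prems(2) sub by (auto intro: antisymp_on_subset)
  ultimately have "take n (trim k xs) = replicate n b" if "n \<le> count_list (trim k xs) b" for n
    using that by (rule take_sorted_wrt_eq_replicate)
  \<comment> \<open>Had the trimmed tail more than \<open>k b\<close> copies of \<open>b\<close>,
    they would form a prefix and \<open>push\<close> would drop the new one.\<close>
  from this[of "Suc (k b)"]
  have "count_list (trim k xs) b < Suc (k b)" if "push k b (trim k xs) \<noteq> trim k xs"
    using that by (auto simp: push_def simp del: replicate_Suc intro: ccontr)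
  then show ?case
    using IH by (auto simp: push_def simp del: replicate_Suc)
qed simp

lemma take_trim_replicate:
  "n \<le> Suc (k a) \<Longrightarrow> take n (trim k (replicate n a @ xs)) = replicate n a"
proof (induction n)
  case (Suc n)
  let ?t = "trim k (replicate n a @ xs)"
  have "take (Suc n) ?t = replicate (Suc n) a" if "take (Suc (k a)) ?t = replicate (Suc (k a)) a"
  proof -
    have "take (Suc n) (take (Suc (k a)) ?t) = take (Suc n) (replicate (Suc (k a)) a)"
      using that by (rule arg_cong)
    then show ?thesis
      using Suc.prems by (simp only: take_take take_replicate min_absorb1)
  qed
  then show ?case
    using Suc by (simp add: push_def)
qed simp

text \<open>A full block absorbs further copies. In \<open>trim_next_row_replicate\<close> this
  erases the difference in length.\<close>

lemma trim_replicate_Suc: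
  assumes "Suc (k a) \<le> m"
  shows "trim k (replicate (Suc m) a @ xs) = trim k (replicate m a @ xs)"
proof -
  have "replicate m a @ xs = replicate (Suc (k a)) a @ replicate (m - Suc (k a)) a @ xs"
    using assms by (metis append.assoc le_add_diff_inverse replicate_add)
  then have "take (Suc (k a)) (trim k (replicate m a @ xs)) = replicate (Suc (k a)) a"
    using take_trim_replicate[of "Suc (k a)" k a] by simp
  then show ?thesis
    by (simp add: push_def)
qed

lemma trim_replicate:
  assumes "xs = [] \<or> hd xs \<noteq> a"
  shows "trim k (replicate m a @ xs) = replicate (min m (Suc (k a))) a @ trim k xs"
proof (induction m)
  case (Suc m)
  show ?case
  proof (cases "Suc (k a) \<le> m")
    case True
    then show ?thesis
      using Suc trim_replicate_Suc[of k a m xs] by (simp add: min_absorb2)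
  next
    case False
    then have "m \<le> k a"
      by simp
    \<comment> \<open>The block has only \<open>m \<le> k a\<close> copies, so index
      \<open>m\<close> would hit the head of \<open>trim k xs\<close>, which is the head of
      \<open>xs\<close> and differs from \<open>a\<close>.\<close>
    have "take (Suc (k a)) (replicate m a @ trim k xs) \<noteq> replicate (Suc (k a)) a"
    proof
      assume eq: "take (Suc (k a)) (replicate m a @ trim k xs) = replicate (Suc (k a)) a"
      have "length (replicate m a @ trim k xs) \<ge> Suc (k a)"
        using arg_cong[OF eq, of length] by simp
      then have "trim k xs \<noteq> []"
        using \<open>m \<le> k a\<close> by auto
      moreover have "take (Suc (k a)) (replicate m a @ trim k xs) ! m = a"
        using eq \<open>m \<le> k a\<close> by (simp del: replicate_Suc take_append)
      ultimately have "hd (trim k xs) = a"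
        using \<open>m \<le> k a\<close> by (simp add: nth_append hd_conv_nth del: take_append)
      then show False
        using assms \<open>trim k xs \<noteq> []\<close> by (simp add: hd_trim)
    qed
    then show ?thesis
      using Suc \<open>m \<le> k a\<close> by (simp add: push_def min_absorb1)
  qed
qed simp

section \<open>Maximal factorizations and minimal rows\<close>

lemma max_fact_Cons:
  assumes "max_fact xs ((a, m) # fs)"
  obtains ys where "xs = replicate m a @ ys" "max_fact ys fs" "m > 0" "ys = [] \<or> hd ys \<noteq> a"
proof
  let ?ys = "concat (map (\<lambda>(A, m). replicate m A) fs)"
  show "xs = replicate m a @ ?ys" "max_fact ?ys fs" "m > 0"
    using assms by (auto simp: max_fact_def distinct_adj_Cons)
  show "?ys = [] \<or> hd ?ys \<noteq> a"
    using assms by (cases fs) (auto simp: max_fact_def hd_append)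
qed

text \<open>Cutting keeps exponents positive and the sequence of block values unchanged, so the
  factorization stays maximal. This ties the recursive \<open>trim\<close> to the blockwise notions
  of minimality and equivalence.\<close>

lemma max_fact_trim:
  "max_fact xs fs \<Longrightarrow> max_fact (trim k xs) (map (\<lambda>(a, m). (a, min m (Suc (k a)))) fs)"
proof (induction fs arbitrary: xs)
  case Nil
  then show ?case
    by (simp add: max_fact_def)
next
  case (Cons f fs)
  let ?cut = "\<lambda>(a, m). (a, min m (Suc (k a)))"
  obtain a m where f: "f = (a, m)"
    by fastforce
  obtain ys where ys: "xs = replicate m a @ ys" "max_fact ys fs" "m > 0" "ys = [] \<or> hd ys \<noteq> a"
    using Cons.prems max_fact_Cons unfolding f by metis
  have "map fst (map ?cut gs) = map fst gs" for gs
    by (induction gs) auto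
  then have dist: "distinct_adj (map fst (map ?cut (f # fs)))"
    using Cons.prems unfolding max_fact_def by metis
  have IH: "trim k ys = concat (map (\<lambda>(a, m). replicate m a) (map ?cut fs))"
    "\<forall>(a, m)\<in>set (map ?cut fs). m > 0"
    using Cons.IH[OF ys(2)] unfolding max_fact_def by blast+
  have "trim k xs = concat (map (\<lambda>(a, m). replicate m a) (map ?cut (f # fs)))"
    using trim_replicate[OF ys(4), of k m] IH(1) f ys(1) by simp
  moreover have "\<forall>(a, m)\<in>set (map ?cut (f # fs)). m > 0"
    using IH(2) f ys(3) by simp
  ultimately show ?case
    using dist unfolding max_fact_def by blast
qed

lemma max_fact_exists: "\<exists>fs. max_fact xs fs"
proof (induction xs)
  case Nil
  show ?case
    by (rule exI[of _ "[]"]) (simp add: max_fact_def)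
next
  case (Cons a xs)
  then obtain fs where fs: "max_fact xs fs" by blast
  show ?case
  proof (cases fs)
    case Nil
    then have "max_fact (a # xs) [(a, 1)]"
      using fs by (simp add: max_fact_def)
    then show ?thesis by blast
  next
    case (Cons f gs)
    obtain b m where f: "f = (b, m)"
      by fastforce
    have "max_fact (a # xs) (if a = b then (b, Suc m) # gs else (a, 1) # fs)"
      using fs Cons f by (auto simp: max_fact_def distinct_adj_Cons)
    then show ?thesis by blast
  qed
qed

lemma max_fact_unique:
  assumes "max_fact xs fs" "max_fact ys fs"
  shows "xs = ys"
  using assms by (simp add: max_fact_def)

lemma trim_minimal:
  assumes "minimal \<phi> xs"
  shows "trim (rank \<phi>) xs = xs"
proof -
  obtain fs where fs: "max_fact xs fs" "\<forall>(A, m)\<in>set fs. m \<le> rank \<phi> A + 1"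
    using assms unfolding minimal_def by blast
  then have "map (\<lambda>(a, m). (a, min m (Suc (rank \<phi> a)))) fs = fs"
    by (auto intro!: map_idI)
  then show ?thesis
    using max_fact_trim[OF fs(1), of "rank \<phi>"] fs(1) max_fact_unique by metis
qed

lemma minimal_trim: "minimal \<phi> (trim (rank \<phi>) xs)"
proof -
  obtain fs where "max_fact xs fs"
    using max_fact_exists by blast
  from max_fact_trim[OF this, of "rank \<phi>"] show ?thesis
    unfolding minimal_def by (intro exI conjI) auto
qed

text \<open>An exponent altered by the cut drops to rank plus one, so old and new exponent both
  exceed the rank.\<close>

lemma row_equiv_trim: "row_equiv \<phi> xs (trim (rank \<phi>) xs)"
proof -
  obtain fs where fs: "max_fact xs fs"
    using max_fact_exists by blast
  show ?thesis
    unfolding row_equiv_def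
    by (rule exI[of _ fs], rule exI, intro conjI, rule fs, rule max_fact_trim[OF fs])
      (simp add: list.rel_map list.rel_refl min_def split: prod.split)
qed

text \<open>Exponents that are equal or both above the rank have the same minimum with rank plus
  one. Thus \<open>trim\<close> is a normal form for equivalence, which yields the uniqueness of the
  minimal row.\<close>

lemma row_equiv_imp_trim_eq:
  assumes "row_equiv \<phi> xs ys"
  shows "trim (rank \<phi>) xs = trim (rank \<phi>) ys"
proof -
  let ?cut = "\<lambda>(a, m). (a, min m (Suc (rank \<phi> a)))"
  obtain fs gs where fs: "max_fact xs fs" and gs: "max_fact ys gs"
    and "list_all2 (\<lambda>(A, m) (B, n). A = B \<and> (m = n \<or> m > rank \<phi> A \<and> n > rank \<phi> A)) fs gs"
    using assms unfolding row_equiv_def by blast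
  from this(3) have "map ?cut fs = map ?cut gs"
    by (induction rule: list_all2_induct) (auto simp: min_def)
  then have "max_fact (trim (rank \<phi>) ys) (map ?cut fs)"
    using max_fact_trim[OF gs, of "rank \<phi>"] by simp
  with max_fact_trim[OF fs] show ?thesis
    by (rule max_fact_unique)
qed


section \<open>Rows\<close>

text \<open>The arguments follow the order of the list, while \<open>D_rel\<close> points from the
  later atom to the earlier one.\<close>

definition row_step :: "'p fm set \<Rightarrow> 'p fm set \<Rightarrow> bool" where
  "row_step A B \<longleftrightarrow> D_rel B A \<and> letters B \<subseteq> letters A"

lemma is_row_iff:
  "is_row \<phi> row \<longleftrightarrow> row \<noteq> [] \<and> (\<forall>A\<in>set row. is_atom \<phi> A) \<and> successively row_step row"
  unfolding is_row_def successively_conv_nth row_step_def by blast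

lemma is_row_trim: "is_row \<phi> row \<Longrightarrow> is_row \<phi> (trim k row)"
  using set_trim successively_trim unfolding is_row_iff by fastforce

lemma row_step_gen_atom:
  assumes "is_atom \<phi> A" "is_atom \<phi> B"
  shows "row_step B (gen_atom \<phi> A B)"
  using gen_gen_atom[OF assms] D_relI[OF is_atom_gen_atom assms(2)]
  by (auto simp: row_step_def gen_def)

text \<open>The current atom of the new row is carried as an accumulator, which turns the
  description in \<open>succ_row\<close> into a recursion along the old row.\<close>

fun next_row :: "'p fm \<Rightarrow> 'p fm set list \<Rightarrow> 'p fm set \<Rightarrow> 'p fm set list" where
  "next_row \<phi> [] B = [B]"
| "next_row \<phi> (A # row) B = B # next_row \<phi> row (gen_atom \<phi> A B)"

lemma next_row_neq_Nil [simp]: "next_row \<phi> row B \<noteq> []"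
  and hd_next_row [simp]: "hd (next_row \<phi> row B) = B"
  by (cases row; simp)+

lemma is_row_next_row:
  "\<lbrakk>\<forall>A\<in>set row. is_atom \<phi> A; is_atom \<phi> B\<rbrakk> \<Longrightarrow> is_row \<phi> (next_row \<phi> row B)"
proof (induction row arbitrary: B)
  case (Cons A row)
  then have "is_row \<phi> (next_row \<phi> row (gen_atom \<phi> A B))"
    by (simp add: is_atom_gen_atom)
  then show ?case
    using Cons.prems by (simp add: is_row_iff successively_Cons row_step_gen_atom)
qed (simp add: is_row_iff)

text \<open>The condition at index 0 forces the second atom by \<open>gen_iff\<close>; the other
  conditions are those for the tails, with the forced atom as start.\<close>

lemma next_row_unique:
  assumes "\<forall>A\<in>set row. is_atom \<phi> A" "is_atom \<phi> B"
  shows "length Bs = length row + 1 \<and> (\<forall>B\<in>set Bs. is_atom \<phi> B)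
     \<and> Bs ! 0 = B \<and> (\<forall>i<length row. gen \<phi> (row ! i) (Bs ! i) (Bs ! (i + 1)))
     \<longleftrightarrow> Bs = next_row \<phi> row B"
  using assms
proof (induction row arbitrary: B Bs)
  case Nil
  then show ?case
    by (cases Bs) auto
next
  case (Cons A row)
  show ?case
  proof (cases Bs)
    case (Cons C Cs)
    have *: "is_atom \<phi> D \<Longrightarrow> gen \<phi> A B D \<longleftrightarrow> D = gen_atom \<phi> A B" for D
      using Cons.prems by (simp add: gen_iff)
    show ?thesis
      using Cons.IH[of "gen_atom \<phi> A B" Cs] Cons.prems Cons is_atom_gen_atom[of \<phi> A B]
      by (cases Cs) (auto simp: All_less_Suc2 *)
  qed simp
qed

lemma succ_row_eq:
  assumes "\<forall>A\<in>set row. is_atom \<phi> A" "is_atom \<phi> B"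
  shows "succ_row \<phi> row B = next_row \<phi> row B"
  unfolding succ_row_def next_row_unique[OF assms] by simp

lemma succ_min_eq:
  assumes "\<forall>A\<in>set row. is_atom \<phi> A" "is_atom \<phi> B"
  shows "succ_min \<phi> row B = trim (rank \<phi>) (next_row \<phi> row B)"
  unfolding succ_min_def succ_row_eq[OF assms]
proof (rule the_equality)
  fix row'
  assume "is_row \<phi> row' \<and> minimal \<phi> row' \<and> row_equiv \<phi> (next_row \<phi> row B) row'"
  then show "row' = trim (rank \<phi>) (next_row \<phi> row B)"
    by (metis row_equiv_imp_trim_eq trim_minimal)
qed (simp add: is_row_trim is_row_next_row assms minimal_trim row_equiv_trim)

section \<open>Cutting commutes with the successor\<close>

lemma rank_antimono: "is_atom \<phi> B \<Longrightarrow> Req A \<subseteq> Req B \<Longrightarrow> rank \<phi> B \<le> rank \<phi> A"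
  unfolding rank_def
  by (meson Req_subset card_mono diff_le_mono2 finite_REQ finite_subset)

lemma rank_strict_antimono:
  assumes "is_atom \<phi> B" "Req A \<subset> Req B"
  shows "rank \<phi> B < rank \<phi> A"
proof -
  \<comment> \<open>The second bound keeps the truncated subtraction in \<open>rank\<close>
    strict.\<close>
  have "card (Req A) < card (Req B)" "card (Req B) \<le> card (REQ \<phi>)"
    using assms by (meson Req_subset card_mono psubset_card_mono finite_REQ finite_subset)+
  then show ?thesis
    by (simp add: rank_def)
qed

lemma next_row_replicate_fixpoint:
  "gen_atom \<phi> A B = B \<Longrightarrow> next_row \<phi> (replicate n A @ row) B = replicate n B @ next_row \<phi> row B"
  by (induction n) auto

text \<open>The assumptions on letters and requests hold for any atom generated from
  \<open>A\<close>. Iteration can then only add observations of \<open>B\<close>: either the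
  requests grow, the rank drops and the induction hypothesis applies to the generated atom, or
  \<open>B\<close> is a fixpoint and its block is already full on both sides.\<close>

lemma trim_next_row_replicate:
  assumes "is_atom \<phi> A" "is_atom \<phi> B" "letters B \<subseteq> letters A" "Req A \<union> Obs \<phi> A \<subseteq> Req B"
    and "rank \<phi> B \<le> n"
  shows "trim (rank \<phi>) (next_row \<phi> (replicate (Suc n) A @ row) B)
    = trim (rank \<phi>) (next_row \<phi> (replicate n A @ row) B)"
  using assms(2-)
proof (induction n arbitrary: B)
  case n: (0 B)
  \<comment> \<open>Here \<open>B\<close> has rank 0, which leaves no room for growth.\<close>
  have "gen_atom \<phi> A B = B"
  proof (rule is_atom_eqI[OF is_atom_gen_atom n(1)])
    have gen: "gen \<phi> A B (gen_atom \<phi> A B)"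
      using assms(1) n(1) by (rule gen_gen_atom)
    then show "letters (gen_atom \<phi> A B) = letters B"
      using n by (auto simp: gen_def)
    have "\<not> Req B \<subset> Req (gen_atom \<phi> A B)"
      using rank_strict_antimono[OF is_atom_gen_atom] n(4) by (metis le_zero_eq not_less_zero)
    then show "Req (gen_atom \<phi> A B) = Req B"
      using gen by (auto simp: gen_def)
  qed
  moreover obtain Bs where "next_row \<phi> row B = B # Bs"
    by (metis hd_next_row list.collapse next_row_neq_Nil)
  ultimately show ?case
    using trim_replicate_Suc[of "rank \<phi>" B "Suc 0" Bs] n by simp
next
  case (Suc n B)
  have gen: "gen \<phi> A B (gen_atom \<phi> A B)"
    using assms(1) Suc.prems(1) by (rule gen_gen_atom)
  show ?case
  proof (cases "Req (gen_atom \<phi> A B) = Req B")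
    case True
    then have stable: "gen_atom \<phi> A B = B"
      using gen Suc.prems by (intro is_atom_eqI[OF is_atom_gen_atom]) (auto simp: gen_def)
    \<comment> \<open>The successor of \<open>row\<close> itself starts with \<open>B\<close>, so
      \<open>m\<close> copies of \<open>A\<close> yield \<open>Suc m\<close> copies of
      \<open>B\<close>; this extra copy lets the bound \<open>n\<close> on the rank suffice.\<close>
    obtain Bs where Bs: "next_row \<phi> row B = B # Bs"
      by (metis hd_next_row list.collapse next_row_neq_Nil)
    have B: "replicate m B @ next_row \<phi> row B = replicate (Suc m) B @ Bs" for m
      unfolding Bs by (simp add: replicate_app_Cons_same)
    then show ?thesis
      using trim_replicate_Suc[of "rank \<phi>" B "Suc (Suc n)" Bs] Suc.prems(4)
      by (simp only: next_row_replicate_fixpoint[OF stable] B Suc_le_mono)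
  next
    case False
    then have "rank \<phi> (gen_atom \<phi> A B) < rank \<phi> B"
      using gen by (intro rank_strict_antimono[OF is_atom_gen_atom]) (auto simp: gen_def)
    then have "trim (rank \<phi>) (next_row \<phi> (replicate (Suc n) A @ row) (gen_atom \<phi> A B))
        = trim (rank \<phi>) (next_row \<phi> (replicate n A @ row) (gen_atom \<phi> A B))"
      using gen Suc.prems by (intro Suc.IH is_atom_gen_atom) (auto simp: gen_def)
    then show ?thesis
      by simp
  qed
qed

lemma trim_next_row_trim:
  assumes "\<forall>A\<in>set row. is_atom \<phi> A" "is_atom \<phi> B"
  shows "trim (rank \<phi>) (next_row \<phi> (trim (rank \<phi>) row) B) = trim (rank \<phi>) (next_row \<phi> row B)"
  using assms
proof (induction row arbitrary: B)
  case (Cons A row)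
  let ?k = "rank \<phi> A" and ?t = "trim (rank \<phi>) row"
  have "trim (rank \<phi>) (next_row \<phi> (A # ?t) B) = trim (rank \<phi>) (next_row \<phi> (A # row) B)"
    using Cons by (simp add: is_atom_gen_atom)
  moreover have "trim (rank \<phi>) (next_row \<phi> (A # ?t) B) = trim (rank \<phi>) (next_row \<phi> ?t B)"
    if "take (Suc ?k) ?t = replicate (Suc ?k) A"
  proof -
    have t: "?t = replicate (Suc ?k) A @ drop (Suc ?k) ?t"
      using that by (metis append_take_drop_id)
    have A: "is_atom \<phi> A"
      using Cons.prems by simp
    have gen: "gen \<phi> A B (gen_atom \<phi> A B)"
      using A Cons.prems(2) by (rule gen_gen_atom)
    \<comment> \<open>One copy of \<open>A\<close> is spent to replace the arbitrary
      \<open>B\<close> by an atom generated from \<open>A\<close>. Its rank is at most that of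
      \<open>A\<close>, so the remaining \<open>rank \<phi> A\<close> copies suffice.\<close>
    then have "trim (rank \<phi>) (next_row \<phi> (replicate (Suc ?k) A @ drop (Suc ?k) ?t) (gen_atom \<phi> A B))
      = trim (rank \<phi>) (next_row \<phi> (replicate ?k A @ drop (Suc ?k) ?t) (gen_atom \<phi> A B))"
      by (intro trim_next_row_replicate[OF A is_atom_gen_atom] rank_antimono[OF is_atom_gen_atom])
        (auto simp: gen_def)
    then have "trim (rank \<phi>) (next_row \<phi> (A # replicate (Suc ?k) A @ drop (Suc ?k) ?t) B)
      = trim (rank \<phi>) (next_row \<phi> (replicate (Suc ?k) A @ drop (Suc ?k) ?t) B)"
      by simp
    then show ?thesis
      using t by metis
  qed
  moreover have "trim (rank \<phi>) (A # row)
      = (if take (Suc ?k) ?t = replicate (Suc ?k) A then ?t else A # ?t)"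
    by (simp only: trim_Cons push_def)
  ultimately show ?case
    by metis
qed simp


section \<open>The automaton\<close>

lemma row_statesI:
  assumes "is_row \<phi> row" "Req (hd row) = {}"
  shows "trim (rank \<phi>) row \<in> row_states \<phi>"
proof -
  have "trim (rank \<phi>) row \<noteq> []"
    using assms(1) by (simp add: is_row_def)
  then show ?thesis
    using assms by (simp add: row_states_def is_row_trim minimal_trim initialized_def
        flip: hd_conv_nth) (simp add: hd_trim)
qed

text \<open>If \<open>A\<close> did not request \<open>\<chi>\<close>, it would contain the box of
  \<open>Neg \<chi>\<close>; \<open>D_rel\<close> would pass this box to \<open>B\<close>, where it
  contradicts \<open>Dia \<chi>\<close>.\<close>

lemma D_relD:
  assumes "is_atom \<phi> A" "is_atom \<phi> B" "D_rel A B"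
  shows "Req B \<subseteq> Req A"
proof
  fix \<chi>
  assume "\<chi> \<in> Req B"
  then have Dia: "Dia \<chi> \<in> B" "Dia \<chi> \<in> CL \<phi>"
    using assms(2) by (auto simp: Req_def is_atom_def)
  have "nf (Box (Neg \<chi>)) = nf (Neg (Dia \<chi>))"
    by (simp add: Box_def nneg_nneg_nf)
  then have "nf (Neg (Dia \<chi>)) \<notin> A"
    using assms Dia unfolding D_rel_def is_atom_def by metis
  then show "\<chi> \<in> Req A"
    using assms(1) Dia unfolding is_atom_def Req_def by blast
qed

text \<open>The antisymmetric relation \<open>row_le\<close> makes equal atoms of a row adjacent, so a minimal row
  contains an atom \<open>A\<close> at most \<open>rank A + 1\<close> times.\<close>

definition row_le :: "'p fm set \<Rightarrow> 'p fm set \<Rightarrow> bool" where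
  "row_le A B \<longleftrightarrow> Req A \<subseteq> Req B \<and> letters B \<subseteq> letters A"

lemma sorted_row:
  assumes "is_row \<phi> row"
  shows "sorted_wrt row_le row"
proof -
  have "successively row_le row"
    unfolding successively_conv_nth
  proof (intro allI impI)
    fix i
    assume i: "Suc i < length row"
    then have "is_atom \<phi> (row ! i)" "is_atom \<phi> (row ! Suc i)"
      "D_rel (row ! Suc i) (row ! i)" "letters (row ! Suc i) \<subseteq> letters (row ! i)"
      using assms by (simp_all add: is_row_def)
    then show "row_le (row ! i) (row ! Suc i)"
      by (simp add: row_le_def D_relD)
  qed
  moreover have "transp row_le"
    unfolding row_le_def by (rule transpI) blast
  ultimately show ?thesis
    using successively_conv_sorted_wrt by blast
qed

lemma count_row_states:
  assumes "row \<in> row_states \<phi>"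
  shows "count_list row A \<le> Suc (rank \<phi> A)"
proof -
  \<comment> \<open>Antisymmetry rests on letters and requests determining an atom, hence the
    restriction to members of the row.\<close>
  have "antisymp_on (set row) row_le"
  proof (rule antisymp_onI)
    fix B C
    assume "B \<in> set row" "C \<in> set row" "row_le B C" "row_le C B"
    moreover from this have "is_atom \<phi> B" "is_atom \<phi> C"
      using assms by (auto simp: row_states_def is_row_def)
    ultimately show "B = C"
      unfolding row_le_def by (meson is_atom_eqI subset_antisym)
  qed
  moreover have "sorted_wrt row_le row" "trim (rank \<phi>) row = row"
    using assms sorted_row trim_minimal unfolding row_states_def by blast+
  ultimately show ?thesis
    using count_list_trim[of row_le row "rank \<phi>" A] by (simp only:)
qed

text \<open>The length of a row is the sum of the multiplicities of the finitely many atoms, so the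
  lengths are bounded.\<close>

lemma finite_row_states: "finite (row_states \<phi>)"
proof -
  let ?At = "{A. is_atom \<phi> A}"
  let ?n = "\<Sum>A\<in>?At. Suc (rank \<phi> A)"
  have "set row \<subseteq> ?At \<and> length row \<le> ?n" if "row \<in> row_states \<phi>" for row
  proof
    show sub: "set row \<subseteq> ?At"
      using that by (auto simp: row_states_def is_row_def)
    show "length row \<le> ?n"
      unfolding sum_count_set[OF sub finite_atoms, symmetric]
      by (rule sum_mono) (rule count_row_states[OF that])
  qed
  then show ?thesis
    by (intro finite_subset[OF _ finite_lists_length_le[OF finite_atoms, of \<phi> ?n]]) auto
qed

lemma init_atom: "is_atom \<phi> (atom_of \<phi> P)" "Req (atom_of \<phi> P) = {}"
  by (simp_all add: atom_of_eq is_atom_mk_atom Req_mk_atom)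

lemma succ_min_row_states:
  assumes "row \<in> row_states \<phi>"
  shows "succ_min \<phi> row (atom_of \<phi> P) \<in> row_states \<phi>"
proof -
  have "\<forall>A\<in>set row. is_atom \<phi> A"
    using assms by (simp add: row_states_def is_row_def)
  then show ?thesis
    by (simp add: succ_min_eq row_statesI is_row_next_row init_atom)
qed

lemma singleton_row_states: "[atom_of \<phi> P] \<in> row_states \<phi>"
proof -
  have "trim (rank \<phi>) [atom_of \<phi> P] \<in> row_states \<phi>"
    by (rule row_statesI) (simp_all add: is_row_iff init_atom)
  then show ?thesis
    by (simp add: push_def)
qed

lemma is_dfa_N_aut: "is_dfa (N_aut \<phi>)"
  unfolding is_dfa_def
proof (intro conjI ballI allI)
  fix q P
  assume "q \<in> states (N_aut \<phi>)"
  then show "delta (N_aut \<phi>) q P \<in> states (N_aut \<phi>)"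
    by (cases q) (auto simp: N_aut_def succ_min_row_states singleton_row_states)
qed (auto simp: N_aut_def finite_row_states)

section \<open>Atoms of the intervals of a word\<close>

definition interval_atom :: "'p fm \<Rightarrow> 'p set list \<Rightarrow> nat \<times> nat \<Rightarrow> 'p fm set" where
  "interval_atom \<phi> w I = truths \<phi> (sat {0..<length w} (word_val w) I)"

lemma is_atom_interval_atom: "is_atom \<phi> (interval_atom \<phi> w I)"
  by (simp add: interval_atom_def is_atom_truths)

text \<open>A one-point interval has no proper subinterval and therefore no requests.\<close>

lemma interval_atom_point:
  assumes "y < length w"
  shows "interval_atom \<phi> w (y, y) = atom_of \<phi> (w ! y)"
proof (rule is_atom_eqI[OF is_atom_interval_atom init_atom(1)])
  show "letters (interval_atom \<phi> w (y, y)) = letters (atom_of \<phi> (w ! y))"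
    unfolding atom_of_eq letters_mk_atom
    using assms by (auto simp: interval_atom_def truths_def letters_def word_val_def)
  show "Req (interval_atom \<phi> w (y, y)) = Req (atom_of \<phi> (w ! y))"
    unfolding init_atom(2) by (auto simp: interval_atom_def truths_def Req_def)
qed

lemma sat_Dia_subinterval:
  assumes "a \<in> S" "b \<in> S" "a \<le> b" "x \<le> a" "b \<le> y" "(a, b) \<noteq> (x, y)"
    and "sat S V (a, b) \<psi> \<or> sat S V (a, b) (Dia \<psi>)"
  shows "sat S V (x, y) (Dia \<psi>)"
  using assms(7)
proof
  assume "sat S V (a, b) \<psi>"
  then show ?thesis
    using assms by auto
next
  assume "sat S V (a, b) (Dia \<psi>)"
  then obtain x' y' where *: "x' \<in> S" "y' \<in> S" "x' \<le> y'" "a \<le> x'" "y' \<le> b" "sat S V (x', y') \<psi>"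
    by auto
  then have "x \<le> x'" "y' \<le> y" "(x', y') \<noteq> (x, y)"
    using assms by auto
  then show ?thesis
    using * unfolding sat.simps fst_conv snd_conv by blast
qed

text \<open>Each proper subinterval of \<open>(x, Suc y)\<close> lies within \<open>(x, y)\<close>
  or \<open>(Suc x, Suc y)\<close>, so it is one of these or a proper subinterval of one. These two
  also cover all its points, which gives the letters.\<close>

lemma interval_atom_gen:
  assumes "x \<le> y" "Suc y < length w"
  shows "gen_atom \<phi> (interval_atom \<phi> w (x, y)) (interval_atom \<phi> w (Suc x, Suc y))
    = interval_atom \<phi> w (x, Suc y)"
proof -
  let ?S = "{0..<length w}" and ?V = "word_val w"
  let ?sat = "sat ?S ?V"
  have Dia: "?sat (x, Suc y) (Dia \<psi>) \<longleftrightarrow> ?sat (x, y) (Dia \<psi>) \<or> ?sat (Suc x, Suc y) (Dia \<psi>)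
      \<or> ?sat (x, y) \<psi> \<or> ?sat (Suc x, Suc y) \<psi>" (is "?L \<longleftrightarrow> ?R") for \<psi>
  proof
    assume ?L
    then obtain x' y' where *: "x' \<le> y'" "x \<le> x'" "y' \<le> Suc y" "(x', y') \<noteq> (x, Suc y)"
      "?sat (x', y') \<psi>" "x' \<in> ?S" "y' \<in> ?S"
      by auto
    then consider "y' \<le> y" "(x', y') = (x, y)" | "y' \<le> y" "(x', y') \<noteq> (x, y)"
      | "y' = Suc y" "(x', y') = (Suc x, Suc y)"
      | "y' = Suc y" "Suc x \<le> x'" "(x', y') \<noteq> (Suc x, Suc y)"
      by fastforce
    then show ?R
    proof cases
      case 2
      then have "?sat (x, y) (Dia \<psi>)"
        using * unfolding sat.simps fst_conv snd_conv by blast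
      then show ?thesis by blast
    next
      case 4
      then have "?sat (Suc x, Suc y) (Dia \<psi>)"
        using * unfolding sat.simps fst_conv snd_conv by blast
      then show ?thesis by blast
    qed (use * in simp_all)
  next
    assume ?R
    then consider "?sat (x, y) \<psi> \<or> ?sat (x, y) (Dia \<psi>)"
      | "?sat (Suc x, Suc y) \<psi> \<or> ?sat (Suc x, Suc y) (Dia \<psi>)"
      by blast
    then show ?L
    proof cases
      case 1
      show ?thesis
        by (rule sat_Dia_subinterval[OF _ _ _ _ _ _ 1]) (use assms in simp_all)
    next
      case 2
      show ?thesis
        by (rule sat_Dia_subinterval[OF _ _ _ _ _ _ 2]) (use assms in simp_all)
    qed
  qed
  have "(\<forall>i\<in>{x..y}. p \<in> w ! i) \<and> (\<forall>i\<in>{Suc x..Suc y}. p \<in> w ! i)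
     \<longleftrightarrow> (\<forall>i\<in>{x..Suc y}. p \<in> w ! i)" for p
    using assms by (auto simp: le_Suc_eq Suc_le_eq)
  then have Atm: "?sat (x, Suc y) (Atm p) \<longleftrightarrow> ?sat (x, y) (Atm p) \<and> ?sat (Suc x, Suc y) (Atm p)" for p
    using assms by (auto simp: word_val_def)
  \<comment> \<open>Observations are confined to the closure; \<open>CL_Dia\<close> supplies
    membership for arguments of closure diamonds.\<close>
  have "gen \<phi> (interval_atom \<phi> w (x, y)) (interval_atom \<phi> w (Suc x, Suc y))
      (interval_atom \<phi> w (x, Suc y))"
    unfolding gen_def interval_atom_def letters_def Req_def Obs_def REQ_def truths_def
    using Atm Dia by (auto simp del: sat.simps dest: CL_Dia)
  then show ?thesis
    by (simp add: gen_iff is_atom_interval_atom)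
qed

section \<open>Columns of a word and the run of the automaton\<close>

text \<open>The column runs leftwards from the one-point interval, so it starts with an atom without
  requests and ends with the atom of \<open>(0, y)\<close>.\<close>

definition word_row :: "'p fm \<Rightarrow> 'p set list \<Rightarrow> nat \<Rightarrow> 'p fm set list" where
  "word_row \<phi> w y = map (\<lambda>i. interval_atom \<phi> w (y - i, y)) [0..<Suc y]"

lemma word_row_Suc:
  assumes "Suc y < length w"
  shows "next_row \<phi> (word_row \<phi> w y) (atom_of \<phi> (w ! Suc y)) = word_row \<phi> w (Suc y)"
proof -
  have len: "length (word_row \<phi> w z) = Suc z" for z
    by (simp add: word_row_def)
  have nth: "word_row \<phi> w z ! i = interval_atom \<phi> w (z - i, z)" if "i < Suc z" for i z
    using that by (simp add: word_row_def del: upt_Suc)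
  \<comment> \<open>Entries \<open>i\<close> of the old and the new column belong to the two maximal
    proper subintervals of the interval at entry \<open>i + 1\<close> of the new one.\<close>
  have gen: "gen \<phi> (word_row \<phi> w y ! i) (word_row \<phi> w (Suc y) ! i) (word_row \<phi> w (Suc y) ! (i + 1))"
    if "i < Suc y" for i
    using that interval_atom_gen[of "y - i" y w \<phi>] assms
    by (simp add: gen_iff is_atom_interval_atom nth Suc_diff_le)
  have atoms: "\<forall>A\<in>set (word_row \<phi> w z). is_atom \<phi> A" for z
    by (auto simp: word_row_def is_atom_interval_atom)
  show ?thesis
    by (rule next_row_unique[OF atoms init_atom(1), THEN iffD1, symmetric])
      (simp add: len nth[of 0] interval_atom_point assms atoms gen[unfolded Suc_eq_plus1[symmetric]])
qed

text \<open>The first letter leaves the fresh state. Afterwards only the trimmed column is stored,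
  and \<open>trim_next_row_trim\<close> shows that it determines the next trimmed column.\<close>

lemma run_eq:
  "y < length w \<Longrightarrow>
    foldl (delta (N_aut \<phi>)) None (take (Suc y) w) = Some (trim (rank \<phi>) (word_row \<phi> w y))"
proof (induction y)
  case 0
  then show ?case
    by (cases w) (auto simp: N_aut_def word_row_def push_def interval_atom_point)
next
  case (Suc y)
  have atoms: "\<forall>A\<in>set (word_row \<phi> w y). is_atom \<phi> A"
    by (auto simp: word_row_def is_atom_interval_atom)
  then have "\<forall>A\<in>set (trim (rank \<phi>) (word_row \<phi> w y)). is_atom \<phi> A"
    using set_trim by fastforce
  then have "succ_min \<phi> (trim (rank \<phi>) (word_row \<phi> w y)) (atom_of \<phi> (w ! Suc y))
    = trim (rank \<phi>) (word_row \<phi> w (Suc y))"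
    using Suc.prems by (simp add: succ_min_eq init_atom trim_next_row_trim[OF atoms] word_row_Suc)
  then show ?case
    using Suc by (simp add: take_Suc_conv_app_nth[of "Suc y"]) (simp add: N_aut_def)
qed

lemma run_in_states:
  "foldl (delta (N_aut \<phi>)) (init (N_aut \<phi>)) w \<in> states (N_aut \<phi>)"
proof -
  have "q \<in> states (N_aut \<phi>) \<Longrightarrow> foldl (delta (N_aut \<phi>)) q w \<in> states (N_aut \<phi>)" for q
    using is_dfa_N_aut[of \<phi>] by (induction w arbitrary: q) (auto simp: is_dfa_def)
  then show ?thesis
    using is_dfa_N_aut[of \<phi>] by (simp add: is_dfa_def)
qed

lemma sat_nf: "sat S V I (nf \<psi>) \<longleftrightarrow> sat S V I \<psi>"
proof (induction \<psi> arbitrary: I)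
  case (Neg \<psi>)
  have "sat S V I (nneg \<chi>) \<longleftrightarrow> \<not> sat S V I \<chi>" for \<chi>
    by (cases \<chi>) auto
  then show ?case
    using Neg by simp
qed auto

theorem theorem4p7:
  fixes \<phi> :: "'p::finite fm"
  shows "is_dfa (N_aut \<phi>) \<and> language (N_aut \<phi>) = {w. w \<noteq> [] \<and> word_sat w \<phi>}"
proof -
  have "w \<in> language (N_aut \<phi>) \<longleftrightarrow> w \<noteq> [] \<and> word_sat w \<phi>" for w
  proof (cases "w = []")
    case True
    then show ?thesis
      by (auto simp: language_def N_aut_def)
  next
    case False
    let ?y = "length w - 1"
    let ?row = "trim (rank \<phi>) (word_row \<phi> w ?y)"
    have run: "foldl (delta (N_aut \<phi>)) (init (N_aut \<phi>)) w = Some ?row"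
      using run_eq[of ?y w \<phi>] False by (simp add: N_aut_def)
    have "?row \<in> row_states \<phi>"
      using run_in_states[of \<phi> w] unfolding run by (auto simp: N_aut_def)
    then have "w \<in> language (N_aut \<phi>) \<longleftrightarrow> nf \<phi> \<in> ?row ! (length ?row - 1)"
      using run by (auto simp: language_def N_aut_def)
    \<comment> \<open>Cutting blocks preserves the last entry, so acceptance inspects the atom of
      the whole word.\<close>
    also have "?row ! (length ?row - 1) = last (word_row \<phi> w ?y)"
      by (subst last_conv_nth[symmetric]) (auto simp: last_trim word_row_def)
    also have "last (word_row \<phi> w ?y) = interval_atom \<phi> w (0, ?y)"
      by (simp add: word_row_def)
    also have "nf \<phi> \<in> interval_atom \<phi> w (0, ?y) \<longleftrightarrow> word_sat w \<phi>"
      by (simp add: interval_atom_def truths_def self_CL sat_nf word_sat_def)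
    finally show ?thesis
      using False by simp
  qed
  then show ?thesis
    using is_dfa_N_aut by blast
qed

end
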